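(* Let $(X,d,\mu,\mathcal{E},\mathcal{F})$ be a non-local regular symmetric Dirichlet space on an Ahlfors $d_H$-regular metric measure space, with conservative semigroup whose heat kernel satisfies, for some $c_3,\ldots,c_6\in(0,\infty)$ and $0<d_W\le d_H+1$, \[ c_5t^{-\frac{d_H}{d_W}}\left(1+c_6\frac{d(x,y)}{t^{1/d_W}}\right)^{-d_H-d_W}\le p_t(x,y)\le c_3t^{-\frac{d_H}{d_W}}\left(1+c_4\frac{d(x,y)}{t^{1/d_W}}\right)^{-d_H-d_W}. \] For any $p\in[1,\infty)$ and $\alpha\in[0,1/p)$ there exist constants $c,C>0$ such that for every $f\in L^p(X,\mu)$, \[ c\,N(f)\le\|f\|_{p,\alpha}\le C\,N(f),\qquad N(f)=\sup_{r>0}\frac1{r^{\alpha d_W+d_H/p}}\left(\iint_{\Delta_r}|f(x)-f(y)|^p\,d\mu(x)\,d\mu(y)\right)^{1/p}. \]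
   Context: $(X,d,\mu)$ is a metric measure space whose balls $B(x,r)=\{y:d(x,y)<r\}$ have compact closure. Ahlfors $d_H$-regular: there are $c_1,c_2,d_H\in(0,\infty)$ with $c_1r^{d_H}\le\mu(B(x,r))\le c_2r^{d_H}$ for all $x\in X$, $r\in(0,\infty)$. The heat kernel bounds hold for $\mu\times\mu$-a.e. $(x,y)$ and all $t\in(0,\infty)$. $\Delta_r=\{(x,y)\in X\times X:d(x,y)<r\}$. The Besov seminorm is \[ \|f\|_{p,\alpha}=\sup_{t>0}t^{-\alpha}\left(\int_X\int_X|f(x)-f(y)|^pp_t(x,y)\,d\mu(x)\,d\mu(y)\right)^{1/p}. \] Both sides may be $+\infty$. *)

theory Defs
  imports "HOL-Analysis.Analysis"
begin

section \<open>Lebesgue spaces\<close>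

text \<open>Elements of L^p are represented by measurable functions; identification up to null sets is
  always made explicit.\<close>

definition Lp :: "real \<Rightarrow> 'a measure \<Rightarrow> ('a \<Rightarrow> real) set" where
  "Lp p M = {f \<in> borel_measurable M. integrable M (\<lambda>x. \<bar>f x\<bar> powr p)}"

definition L2_inner :: "'a measure \<Rightarrow> ('a \<Rightarrow> real) \<Rightarrow> ('a \<Rightarrow> real) \<Rightarrow> real" where
  "L2_inner M f g = (LINT x|M. f x * g x)"

definition L2_norm :: "'a measure \<Rightarrow> ('a \<Rightarrow> real) \<Rightarrow> real" where
  "L2_norm M f = sqrt (L2_inner M f f)"

text \<open>Powers with exponent \<open>a > 0\<close> on the extended half-line.\<close>

definition ennreal_powr :: "ennreal \<Rightarrow> real \<Rightarrow> ennreal" where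
  "ennreal_powr x a = (if x = top then top else ennreal (enn2real x powr a))"


section \<open>Metric measure spaces\<close>

definition metric_measure_space :: "'a::metric_space measure \<Rightarrow> bool" where
  "metric_measure_space M \<longleftrightarrow>
     sets M = sets borel \<and> (\<forall>(x::'a) r. compact (closure (ball x r)))"

definition ahlfors_regular :: "'a::metric_space measure \<Rightarrow> real \<Rightarrow> bool" where
  "ahlfors_regular M dH \<longleftrightarrow> 0 < dH \<and>
     (\<exists>c1>0. \<exists>c2>0. \<forall>x. \<forall>r>0.
        ennreal (c1 * r powr dH) \<le> emeasure M (ball x r) \<and>
        emeasure M (ball x r) \<le> ennreal (c2 * r powr dH))"

text \<open>The support of the measure \<open>f \<cdot> \<mu>\<close>: complement of the union of all open sets on which \<open>f\<close>
  vanishes almost everywhere.\<close>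

definition measure_support :: "'a::topological_space measure \<Rightarrow> ('a \<Rightarrow> real) \<Rightarrow> 'a set" where
  "measure_support M f = - \<Union>{U. open U \<and> (AE x in M. x \<in> U \<longrightarrow> f x = 0)}"

definition Cc :: "('a::topological_space \<Rightarrow> real) set" where
  "Cc = {f. continuous_on UNIV f \<and> compact (closure {x. f x \<noteq> 0})}"


section \<open>Symmetric Dirichlet forms\<close>

text \<open>The norm of the form domain, given by E(f,f) + (f,f).\<close>

definition form_norm ::
    "'a measure \<Rightarrow> (('a \<Rightarrow> real) \<Rightarrow> ('a \<Rightarrow> real) \<Rightarrow> real) \<Rightarrow> ('a \<Rightarrow> real) \<Rightarrow> real" where
  "form_norm M E f = sqrt (E f f + L2_inner M f f)"

locale dirichlet_form =
  fixes M :: "'a measure"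
    and F :: "('a \<Rightarrow> real) set"
    and E :: "('a \<Rightarrow> real) \<Rightarrow> ('a \<Rightarrow> real) \<Rightarrow> real"
  assumes domain_L2: "F \<subseteq> Lp 2 M"
    and domain_cong: "\<And>f g. f \<in> F \<Longrightarrow> g \<in> Lp 2 M \<Longrightarrow> (AE x in M. f x = g x) \<Longrightarrow> g \<in> F"
    and form_cong: "\<And>f g h. f \<in> F \<Longrightarrow> g \<in> F \<Longrightarrow> h \<in> F \<Longrightarrow> (AE x in M. f x = g x) \<Longrightarrow> E f h = E g h"
    and domain_add: "\<And>f g. f \<in> F \<Longrightarrow> g \<in> F \<Longrightarrow> (\<lambda>x. f x + g x) \<in> F"
    and domain_scale: "\<And>a f. f \<in> F \<Longrightarrow> (\<lambda>x. a * f x) \<in> F"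
    and domain_dense: "\<And>f e. f \<in> Lp 2 M \<Longrightarrow> 0 < e \<Longrightarrow> \<exists>g\<in>F. L2_norm M (\<lambda>x. f x - g x) < e"
    and form_add: "\<And>f g h. f \<in> F \<Longrightarrow> g \<in> F \<Longrightarrow> h \<in> F \<Longrightarrow> E (\<lambda>x. f x + g x) h = E f h + E g h"
    and form_scale: "\<And>a f h. f \<in> F \<Longrightarrow> h \<in> F \<Longrightarrow> E (\<lambda>x. a * f x) h = a * E f h"
    and form_sym: "\<And>f g. f \<in> F \<Longrightarrow> g \<in> F \<Longrightarrow> E f g = E g f"
    and form_nonneg: "\<And>f. f \<in> F \<Longrightarrow> 0 \<le> E f f"
    and form_closed: "\<And>u :: nat \<Rightarrow> 'a \<Rightarrow> real. (\<And>n. u n \<in> F) \<Longrightarrow>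
        (\<And>e. 0 < e \<Longrightarrow> \<exists>N. \<forall>m\<ge>N. \<forall>n\<ge>N. form_norm M E (\<lambda>x. u m x - u n x) < e) \<Longrightarrow>
        \<exists>f\<in>F. (\<lambda>n. form_norm M E (\<lambda>x. u n x - f x)) \<longlonglongrightarrow> 0"
    and markovian: "\<And>f. f \<in> F \<Longrightarrow> (\<lambda>x. min 1 (max 0 (f x))) \<in> F \<and>
        E (\<lambda>x. min 1 (max 0 (f x))) (\<lambda>x. min 1 (max 0 (f x))) \<le> E f f"

locale regular_dirichlet_form = dirichlet_form M F E
  for M :: "'a::metric_space measure" and F E +
  assumes core_dense_domain:
      "\<And>f e. f \<in> F \<Longrightarrow> 0 < e \<Longrightarrow> \<exists>g \<in> F \<inter> Cc. form_norm M E (\<lambda>x. f x - g x) < e"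
    and core_dense_Cc:
      "\<And>f e. f \<in> Cc \<Longrightarrow> 0 < e \<Longrightarrow> \<exists>g \<in> F \<inter> Cc. \<forall>x. \<bar>f x - g x\<bar> < e"

definition local_form ::
    "'a::topological_space measure \<Rightarrow> ('a \<Rightarrow> real) set \<Rightarrow>
     (('a \<Rightarrow> real) \<Rightarrow> ('a \<Rightarrow> real) \<Rightarrow> real) \<Rightarrow> bool" where
  "local_form M F E \<longleftrightarrow> (\<forall>f\<in>F. \<forall>g\<in>F.
     compact (measure_support M f) \<longrightarrow> compact (measure_support M g) \<longrightarrow>
     measure_support M f \<inter> measure_support M g = {} \<longrightarrow> E f g = 0)"


section \<open>Heat semigroup and heat kernel\<close>

text \<open>Strongly continuous symmetric contraction semigroups on L^2. The values of \<open>P t f\<close> matter only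
  for \<open>t > 0\<close> and \<open>f\<close> in L^2; additivity and contractivity make \<open>P t\<close> compatible with equality
  almost everywhere.\<close>

locale symmetric_semigroup =
  fixes M :: "'a measure" and P :: "real \<Rightarrow> ('a \<Rightarrow> real) \<Rightarrow> 'a \<Rightarrow> real"
  assumes semigroup_L2: "\<And>t f. 0 < t \<Longrightarrow> f \<in> Lp 2 M \<Longrightarrow> P t f \<in> Lp 2 M"
    and semigroup_add: "\<And>t f g. 0 < t \<Longrightarrow> f \<in> Lp 2 M \<Longrightarrow> g \<in> Lp 2 M \<Longrightarrow>
        AE x in M. P t (\<lambda>y. f y + g y) x = P t f x + P t g x"
    and semigroup_scale: "\<And>t a f. 0 < t \<Longrightarrow> f \<in> Lp 2 M \<Longrightarrow>
        AE x in M. P t (\<lambda>y. a * f y) x = a * P t f x"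
    and semigroup_comp: "\<And>s t f. 0 < s \<Longrightarrow> 0 < t \<Longrightarrow> f \<in> Lp 2 M \<Longrightarrow>
        AE x in M. P (s + t) f x = P s (P t f) x"
    and semigroup_sym: "\<And>t f g. 0 < t \<Longrightarrow> f \<in> Lp 2 M \<Longrightarrow> g \<in> Lp 2 M \<Longrightarrow>
        L2_inner M (P t f) g = L2_inner M f (P t g)"
    and semigroup_contraction: "\<And>t f. 0 < t \<Longrightarrow> f \<in> Lp 2 M \<Longrightarrow> L2_norm M (P t f) \<le> L2_norm M f"
    and semigroup_continuous: "\<And>f. f \<in> Lp 2 M \<Longrightarrow>
        ((\<lambda>t. L2_norm M (\<lambda>x. P t f x - f x)) \<longlongrightarrow> 0) (at_right 0)"

text \<open>\<open>generates M P f g\<close>: \<open>f\<close> lies in the domain of the L^2-generator of \<open>P\<close>, which maps it to \<open>g\<close>.\<close>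

definition generates ::
    "'a measure \<Rightarrow> (real \<Rightarrow> ('a \<Rightarrow> real) \<Rightarrow> 'a \<Rightarrow> real) \<Rightarrow> ('a \<Rightarrow> real) \<Rightarrow> ('a \<Rightarrow> real) \<Rightarrow> bool" where
  "generates M P f g \<longleftrightarrow> f \<in> Lp 2 M \<and> g \<in> Lp 2 M \<and>
     ((\<lambda>t. L2_norm M (\<lambda>x. (P t f x - f x) / t - g x)) \<longlongrightarrow> 0) (at_right 0)"

text \<open>The semigroup of a closed symmetric form (E,F) is the one whose generator L satisfies
  dom(L) \<open>\<subseteq>\<close> F and E(f,h) = -(Lf,h) for f in dom(L) and h in F.\<close>

locale heat_semigroup = symmetric_semigroup M P
  for M :: "'a measure" and F :: "('a \<Rightarrow> real) set"
    and E :: "('a \<Rightarrow> real) \<Rightarrow> ('a \<Rightarrow> real) \<Rightarrow> real" and P +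
  assumes generator_domain: "\<And>f g. generates M P f g \<Longrightarrow> f \<in> F"
    and generator_form: "\<And>f g h. generates M P f g \<Longrightarrow> h \<in> F \<Longrightarrow> E f h = - L2_inner M g h"

text \<open>\<open>P\<^sub>t 1 = 1\<close>, where \<open>P\<^sub>t 1\<close> is defined by monotone approximation of the constant 1 by functions in
  L^2.\<close>

definition conservative ::
    "'a measure \<Rightarrow> (real \<Rightarrow> ('a \<Rightarrow> real) \<Rightarrow> 'a \<Rightarrow> real) \<Rightarrow> bool" where
  "conservative M P \<longleftrightarrow> (\<forall>t>0. \<forall>u :: nat \<Rightarrow> 'a \<Rightarrow> real.
     (\<forall>n. u n \<in> Lp 2 M) \<longrightarrow>
     (AE x in M. 0 \<le> u 0 x \<and> incseq (\<lambda>n. u n x) \<and> (\<lambda>n. u n x) \<longlonglongrightarrow> 1) \<longrightarrow>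
     (AE x in M. (\<lambda>n. P t (u n) x) \<longlonglongrightarrow> 1))"

definition heat_kernel ::
    "'a measure \<Rightarrow> (real \<Rightarrow> ('a \<Rightarrow> real) \<Rightarrow> 'a \<Rightarrow> real) \<Rightarrow> (real \<Rightarrow> 'a \<Rightarrow> 'a \<Rightarrow> real) \<Rightarrow> bool" where
  "heat_kernel M P k \<longleftrightarrow> (\<forall>t>0.
     (\<lambda>(x, y). k t x y) \<in> borel_measurable (M \<Otimes>\<^sub>M M) \<and>
     (\<forall>x y. 0 \<le> k t x y) \<and>
     (\<forall>f\<in>Lp 2 M. AE x in M.
        integrable M (\<lambda>y. k t x y * f y) \<and> P t f x = (LINT y|M. k t x y * f y)))"


section \<open>Besov seminorms\<close>

definition besov_seminorm ::
    "'a measure \<Rightarrow> (real \<Rightarrow> 'a \<Rightarrow> 'a \<Rightarrow> real) \<Rightarrow> real \<Rightarrow> real \<Rightarrow> ('a \<Rightarrow> real) \<Rightarrow> ennreal" where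
  "besov_seminorm M k p \<alpha> f = (SUP t\<in>{0<..}. ennreal (t powr (- \<alpha>)) *
     ennreal_powr (\<integral>\<^sup>+ y. (\<integral>\<^sup>+ x. ennreal (\<bar>f x - f y\<bar> powr p * k t x y) \<partial>M) \<partial>M) (1 / p))"

definition Delta :: "real \<Rightarrow> ('a::metric_space \<times> 'a) set" where
  "Delta r = {(x, y). dist x y < r}"

definition besov_metric_seminorm ::
    "'a::metric_space measure \<Rightarrow> real \<Rightarrow> real \<Rightarrow> real \<Rightarrow> real \<Rightarrow> ('a \<Rightarrow> real) \<Rightarrow> ennreal" where
  "besov_metric_seminorm M dH dW p \<alpha> f = (SUP r\<in>{0<..}. ennreal (1 / r powr (\<alpha> * dW + dH / p)) *
     ennreal_powr (\<integral>\<^sup>+ z\<in>Delta r. ennreal (\<bar>f (fst z) - f (snd z)\<bar> powr p) \<partial>(M \<Otimes>\<^sub>M M)) (1 / p))"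

end

theory Submission
  imports Defs
begin

text \<open>With \<open>t = r powr dW\<close>, the lower heat kernel bound on \<open>Delta r\<close> is of order \<open>r powr - dH\<close>, so a
  single scale \<open>r\<close> of the metric seminorm is controlled by a single time of the heat seminorm.
  Conversely, splitting \<open>X \<times> X\<close> into dyadic annuli around the diagonal, the upper bound dominates
  \<open>k t\<close> by a series of multiples of indicators of \<open>Delta (2 ^ n * r)\<close>. Inserting the metric seminorm
  at each scale leaves a geometric series of ratio \<open>2 powr (dW * (p * \<alpha> - 1))\<close>, which converges
  exactly because \<open>\<alpha> < 1 / p\<close>.\<close>

section \<open>Powers and roots on the extended half-line\<close>

lemma ennreal_powr_mono:
  assumes "0 < a" "x \<le> y"
  shows "ennreal_powr x a \<le> ennreal_powr y a"
proof (cases "y = top")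
  case False
  then have "x \<noteq> top" "enn2real x \<le> enn2real y"
    using assms(2) by (auto simp: top_unique less_top intro!: enn2real_mono)
  then show ?thesis
    using False assms(1) by (auto simp: ennreal_powr_def intro!: ennreal_leI powr_mono2)
qed (simp add: ennreal_powr_def)

lemma ennreal_powr_ennreal: "0 \<le> x \<Longrightarrow> ennreal_powr (ennreal x) a = ennreal (x powr a)"
  by (simp add: ennreal_powr_def)

lemma ennreal_powr_cmult:
  assumes "0 < c"
  shows "ennreal_powr (ennreal c * x) a = ennreal (c powr a) * ennreal_powr x a"
  using assms
  by (cases x)
     (auto simp: ennreal_powr_ennreal powr_mult ennreal_mult'' [symmetric] ennreal_mult_top
       ennreal_powr_def)

lemma ennreal_powr_le_imp_le:
  assumes "0 < p" "0 \<le> b" "ennreal_powr x (1 / p) \<le> ennreal b"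
  shows "x \<le> ennreal (b powr p)"
proof (cases x)
  case (real u)
  then have "u powr (1 / p) \<le> b"
    using assms by (simp add: ennreal_powr_ennreal)
  then have "(u powr (1 / p)) powr p \<le> b powr p"
    using assms by (intro powr_mono2) auto
  then show ?thesis
    using real assms by (simp add: powr_powr ennreal_leI)
qed (use assms(3) in \<open>simp add: ennreal_powr_def top_unique\<close>)

section \<open>Measure-theoretic preliminaries: separability, measurability of
  \<open>Delta r\<close>, sigma-finiteness\<close>

text \<open>Balls of integer radius about a fixed point exhaust the space and are totally bounded;
  the union of finite nets of mesh \<open>1 / Suc m\<close> in all of them is countable and
  dense.\<close>

lemma separable_of_compact_closure_ball:
  assumes "\<And>(x::'a::metric_space) r. compact (closure (ball x r))"
  obtains D :: "'a::metric_space set" where "countable D" "\<And>(x::'a) e. 0 < e \<Longrightarrow> \<exists>d\<in>D. dist x d < e"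
proof -
  fix a :: 'a
  have "\<exists>k. finite k \<and> closure (ball a (real n)) \<subseteq> (\<Union>x\<in>k. ball x (1 / Suc m))" for n m :: nat
    using assms [of a "real n"] seq_compact_imp_totally_bounded [of "closure (ball a (real n))"]
    unfolding compact_eq_seq_compact_metric
    by (metis of_nat_0_less_iff zero_less_Suc zero_less_divide_1_iff)
  then obtain K where K: "\<And>n m. finite (K n m)"
      "\<And>n m. closure (ball a (real n)) \<subseteq> (\<Union>x\<in>K n m. ball x (1 / real (Suc m)))"
    by metis
  show thesis
  proof
    show "countable (\<Union>n m. K n m)"
      using K(1) by (intro countable_UN) (auto intro: countable_finite)
    fix x :: 'a and e :: real
    assume "0 < e"
    then obtain m where m: "1 / real (Suc m) < e"
      using nat_approx_posE by blast
    obtain n where "dist a x < real n"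
      using reals_Archimedean2 by blast
    then have "x \<in> closure (ball a (real n))"
      using closure_subset by fastforce
    then obtain d where "d \<in> K n m" "dist x d < 1 / real (Suc m)"
      using K(2) by (fastforce simp: dist_commute)
    then show "\<exists>d\<in>(\<Union>n m. K n m). dist x d < e"
      using m by force
  qed
qed

text \<open>The product of two Borel sigma-algebras can miss open sets of the product when the space
  is not separable. Hence \<open>Delta r\<close> is written as a countable union of rectangles of
  balls, with centres in a countable dense set and rational radii \<open>s\<close>.\<close>

lemma Delta_measurable:
  fixes M :: "'a::metric_space measure"
  assumes "metric_measure_space M"
  shows "Delta r \<in> sets (M \<Otimes>\<^sub>M M)"
proof -
  have [measurable_cong]: "sets M = sets borel"
    using assms by (simp add: metric_measure_space_def)
  have compact_balls: "compact (closure (ball x s))" for x :: 'a and s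
    using assms by (simp add: metric_measure_space_def)
  obtain D :: "'a set" where D: "countable D" "\<And>(x::'a) e. 0 < e \<Longrightarrow> \<exists>d\<in>D. dist x d < e"
    using separable_of_compact_closure_ball [OF compact_balls] by blast
  have "Delta r = (\<Union>d\<in>D. \<Union>s\<in>\<rat>. ball d s \<times> ball d (r - s))"
  proof (intro equalityI subsetI)
    fix z :: "'a \<times> 'a"
    assume "z \<in> Delta r"
    then obtain x y where z: "z = (x, y)" "dist x y < r"
      by (auto simp: Delta_def)
    \<comment> \<open>Taking \<open>d\<close> within half the slack of \<open>x\<close> keeps
      \<open>dist x d + dist d y\<close> below \<open>r\<close>, which leaves room for a rational
      \<open>s\<close>.\<close>
    then obtain d where d: "d \<in> D" "dist x d < (r - dist x y) / 2"
      using D(2) [of "(r - dist x y) / 2" x] by auto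
    have "dist d y \<le> dist x d + dist x y"
      by (metis dist_commute dist_triangle)
    then have "dist x d < r - dist d y"
      using d(2) by (simp add: field_simps)
    then obtain s where "s \<in> \<rat>" "dist x d < s" "s < r - dist d y"
      using Rats_dense_in_real by blast
    then show "z \<in> (\<Union>d\<in>D. \<Union>s\<in>\<rat>. ball d s \<times> ball d (r - s))"
      using z d(1) by (force simp: dist_commute)
  next
    fix z assume "z \<in> (\<Union>d\<in>D. \<Union>s\<in>\<rat>. ball d s \<times> ball d (r - s))"
    then obtain d s x y where "z = (x, y)" "dist d x < s" "dist d y < r - s"
      by auto
    moreover have "dist x y \<le> dist d x + dist d y"
      by (metis dist_commute dist_triangle)
    ultimately show "z \<in> Delta r"
      by (simp add: Delta_def)
  qed
  also have "\<dots> \<in> sets (M \<Otimes>\<^sub>M M)"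
  proof (intro sets.countable_UN'' D(1) countable_rat pair_measureI)
  qed (auto simp: \<open>sets M = sets borel\<close>)
  finally show ?thesis .
qed

text \<open>The upper volume bound makes balls of integer radius finite in measure, and they cover
  the space. This justifies Tonelli's theorem later.\<close>

lemma ahlfors_regular_sigma_finite:
  fixes M :: "'a::metric_space measure"
  assumes "metric_measure_space M" "ahlfors_regular M dH"
  shows "sigma_finite_measure M"
proof -
  have sets_M: "sets M = sets borel"
    using assms(1) by (simp add: metric_measure_space_def)
  then have space_M: "space M = UNIV"
    using sets_eq_imp_space_eq [of M borel] by simp
  fix a :: 'a
  have fin: "emeasure M (ball a r) \<noteq> \<infinity>" for r
  proof (cases "0 < r")
    case True
    then obtain c2 where "emeasure M (ball a r) \<le> ennreal (c2 * r powr dH)"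
      using assms(2) unfolding ahlfors_regular_def by blast
    then show ?thesis
      by (auto simp: top_unique)
  qed (simp add: ball_empty)
  have "(\<Union>n. ball a (real n)) = UNIV"
    using reals_Archimedean2 by (auto simp: set_eq_iff)
  then show ?thesis
    using fin sets_M space_M
    by (intro sigma_finite_measure.intro exI [of _ "range (\<lambda>n. ball a (real n))"]) force
qed

section \<open>Lower bound for the heat seminorm: one radius against one time\<close>

locale kernel_comparison =
  fixes M :: "'a::metric_space measure" and k :: "real \<Rightarrow> 'a \<Rightarrow> 'a \<Rightarrow> real"
    and dH dW c3 c4 c5 c6 p \<alpha> :: real
  assumes sigma_finite: "sigma_finite_measure M"
    and Delta_sets [measurable]: "\<And>r. Delta r \<in> sets (M \<Otimes>\<^sub>M M)"
    and kernel_measurable: "\<And>t. 0 < t \<Longrightarrow> (\<lambda>(x, y). k t x y) \<in> borel_measurable (M \<Otimes>\<^sub>M M)"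
    and dH_pos: "0 < dH" and dW_pos: "0 < dW"
    and c3_pos: "0 < c3" and c4_pos: "0 < c4" and c5_pos: "0 < c5" and c6_pos: "0 < c6"
    and kernel_bounds: "\<And>t. 0 < t \<Longrightarrow> AE (x, y) in M \<Otimes>\<^sub>M M.
           c5 * t powr (- (dH / dW)) * (1 + c6 * (dist x y / t powr (1 / dW))) powr (- dH - dW) \<le> k t x y \<and>
           k t x y \<le> c3 * t powr (- (dH / dW)) * (1 + c4 * (dist x y / t powr (1 / dW))) powr (- dH - dW)"
    and p_pos: "0 < p" and \<alpha>_less: "\<alpha> < 1 / p"
begin

text \<open>At time \<open>r powr dW\<close> the length scale \<open>t powr (1 / dW)\<close> is
  \<open>r\<close> and the prefactor \<open>t powr (- (dH / dW))\<close> is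
  \<open>r powr - dH\<close>.\<close>

lemma kernel_bounds_powr:
  assumes "0 < r"
  shows "AE z in M \<Otimes>\<^sub>M M.
    c5 * r powr - dH * (1 + c6 * (dist (fst z) (snd z) / r)) powr (- dH - dW)
      \<le> k (r powr dW) (fst z) (snd z) \<and>
    k (r powr dW) (fst z) (snd z)
      \<le> c3 * r powr - dH * (1 + c4 * (dist (fst z) (snd z) / r)) powr (- dH - dW)"
  using kernel_bounds [of "r powr dW"] assms dW_pos by (simp add: powr_powr split_beta)

lemma double_integral_eq:
  assumes "0 < t" "f \<in> borel_measurable M"
  shows "(\<integral>\<^sup>+ y. (\<integral>\<^sup>+ x. ennreal (\<bar>f x - f y\<bar> powr p * k t x y) \<partial>M) \<partial>M) =
    (\<integral>\<^sup>+ z. ennreal (\<bar>f (fst z) - f (snd z)\<bar> powr p * k t (fst z) (snd z)) \<partial>(M \<Otimes>\<^sub>M M))"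
proof -
  interpret pair_sigma_finite M M
    using sigma_finite by (simp add: pair_sigma_finite_def)
  note [measurable] = assms(2)
  have [measurable]: "(\<lambda>z. k t (fst z) (snd z)) \<in> borel_measurable (M \<Otimes>\<^sub>M M)"
    using kernel_measurable [OF assms(1)] by (simp add: split_beta')
  show ?thesis
    by (subst nn_integral_snd [symmetric]) simp_all
qed

text \<open>On \<open>Delta r\<close> the quotient \<open>dist / r\<close> is below 1 and the decay
  exponent is negative, so the decay factor is at least \<open>(1 + c6) powr (- dH - dW)\<close>.
  Off \<open>Delta r\<close> the left integrand vanishes.\<close>

lemma Delta_integral_le:
  assumes "0 < r" "f \<in> borel_measurable M"
  shows "ennreal (c5 * (1 + c6) powr (- dH - dW) * r powr - dH) *
      (\<integral>\<^sup>+ z\<in>Delta r. ennreal (\<bar>f (fst z) - f (snd z)\<bar> powr p) \<partial>(M \<Otimes>\<^sub>M M))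
    \<le> (\<integral>\<^sup>+ z. ennreal (\<bar>f (fst z) - f (snd z)\<bar> powr p * k (r powr dW) (fst z) (snd z)) \<partial>(M \<Otimes>\<^sub>M M))"
    (is "ennreal ?A * _ \<le> _")
proof -
  note [measurable] = assms(2)
  have A: "0 \<le> ?A"
    using c5_pos by simp
  have "AE z in M \<Otimes>\<^sub>M M. ennreal ?A *
        (ennreal (\<bar>f (fst z) - f (snd z)\<bar> powr p) * indicator (Delta r) z)
      \<le> ennreal (\<bar>f (fst z) - f (snd z)\<bar> powr p * k (r powr dW) (fst z) (snd z))"
    using kernel_bounds_powr [OF assms(1)]
  proof eventually_elim
    case (elim z)
    show ?case
    proof (cases "z \<in> Delta r")
      case True
      then have "dist (fst z) (snd z) / r \<le> 1"
        using assms(1) by (auto simp: Delta_def)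
      then have "(1 + c6) powr (- dH - dW)
          \<le> (1 + c6 * (dist (fst z) (snd z) / r)) powr (- dH - dW)"
        using c6_pos dH_pos dW_pos assms(1)
        by (intro powr_mono2' add_left_mono mult_left_le add_pos_nonneg) auto
      then have "?A \<le> k (r powr dW) (fst z) (snd z)"
        using elim c5_pos by (smt (verit, best) mult.assoc mult.commute mult_left_mono powr_ge_zero zero_le_mult_iff)
      then show ?thesis
        using True A mult_right_mono [of ?A _ "\<bar>f (fst z) - f (snd z)\<bar> powr p"]
        by (simp add: ennreal_mult'' [symmetric] mult.commute ennreal_leI)
    qed simp
  qed
  then show ?thesis
    by (subst nn_integral_cmult [symmetric]) (auto intro: nn_integral_mono_AE)
qed

lemma besov_metric_seminorm_le:
  assumes "f \<in> borel_measurable M"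
  shows "ennreal ((c5 * (1 + c6) powr (- dH - dW)) powr (1 / p)) * besov_metric_seminorm M dH dW p \<alpha> f
    \<le> besov_seminorm M k p \<alpha> f" (is "ennreal (?B powr (1 / p)) * _ \<le> _")
  unfolding besov_metric_seminorm_def SUP_mult_left_ennreal
proof (intro SUP_least)
  fix r :: real
  assume "r \<in> {0<..}"
  then have r: "0 < r"
    by simp
  let ?J = "\<integral>\<^sup>+ z\<in>Delta r. ennreal (\<bar>f (fst z) - f (snd z)\<bar> powr p) \<partial>(M \<Otimes>\<^sub>M M)"
  let ?I = "\<lambda>t. \<integral>\<^sup>+ y. (\<integral>\<^sup>+ x. ennreal (\<bar>f x - f y\<bar> powr p * k t x y) \<partial>M) \<partial>M"
  have B: "0 < ?B"
    using c5_pos c6_pos by simp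
  \<comment> \<open>The two weights match: the time weight at \<open>r powr dW\<close> supplies
    \<open>\<alpha> * dW\<close>, and the p-th root of the kernel size \<open>r powr - dH\<close>
    supplies \<open>dH / p\<close>.\<close>
  have "1 / r powr (\<alpha> * dW + dH / p) * ?B powr (1 / p)
      = (r powr dW) powr - \<alpha> * (?B * r powr - dH) powr (1 / p)"
    using r powr_mult [of ?B "r powr - dH" "1 / p"]
    by (simp add: powr_powr powr_minus_divide [symmetric] powr_add [symmetric] algebra_simps)
  then have "ennreal (?B powr (1 / p)) *
        (ennreal (1 / r powr (\<alpha> * dW + dH / p)) * ennreal_powr ?J (1 / p))
      = ennreal ((r powr dW) powr - \<alpha>) * ennreal_powr (ennreal (?B * r powr - dH) * ?J) (1 / p)"
    using r c5_pos c6_pos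
    by (subst ennreal_powr_cmult)
       (simp_all add: mult.assoc [symmetric] ennreal_mult'' [symmetric] mult.commute)
  also have "\<dots> \<le> ennreal ((r powr dW) powr - \<alpha>) * ennreal_powr (?I (r powr dW)) (1 / p)"
    using Delta_integral_le [OF r assms] double_integral_eq [of "r powr dW" f] r assms p_pos
    by (intro mult_left_mono ennreal_powr_mono) auto
  also have "\<dots> \<le> besov_seminorm M k p \<alpha> f"
    unfolding besov_seminorm_def using r by (intro SUP_upper) auto
  finally show "ennreal (?B powr (1 / p)) *
      (ennreal (1 / r powr (\<alpha> * dW + dH / p)) * ennreal_powr ?J (1 / p)) \<le> besov_seminorm M k p \<alpha> f" .
qed

section \<open>Upper bound for the heat seminorm: dyadic annuli and a geometric series\<close>

text \<open>The maximum serves both cases of the decay estimate: 1 for the innermost region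
  \<open>d < r\<close>, the other entry for the annuli outside it.\<close>

definition annulus_const :: real where
  "annulus_const = max 1 ((c4 / 2) powr (- dH - dW))"

text \<open>The sum of the geometric series with first term \<open>c3 * annulus_const\<close> and
  the ratio bounded in \<open>ratio_less_1\<close>.\<close>

definition series_const :: real where
  "series_const = c3 * annulus_const / (1 - 2 powr (dW * (p * \<alpha> - 1)))"

lemma annulus_const_ge_1: "1 \<le> annulus_const"
  by (simp add: annulus_const_def)

lemma ratio_less_1: "2 powr (dW * (p * \<alpha> - 1)) < (1 :: real)"
proof -
  have "dW * (p * \<alpha> - 1) < 0"
    using p_pos \<alpha>_less dW_pos by (intro mult_pos_neg) (auto simp: field_simps)
  then show ?thesis
    using powr_less_mono [of "dW * (p * \<alpha> - 1)" 0 2] by simp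
qed

lemma series_const_pos: "0 < series_const"
  using ratio_less_1 annulus_const_ge_1 c3_pos by (simp add: series_const_def)

text \<open>For the least \<open>n\<close> with \<open>d < 2 ^ n * r\<close>, minimality bounds
  \<open>d / r\<close> from below by \<open>2 ^ (n - 1)\<close> unless \<open>n = 0\<close>; the
  lost factor 2 is the one in \<open>c4 / 2\<close>.\<close>

lemma decay_le_annulus:
  assumes "0 < r" "0 \<le> d"
  shows "\<exists>n. d < 2 ^ n * r \<and>
    (1 + c4 * (d / r)) powr (- dH - dW) \<le> annulus_const * (2 powr (- dH - dW)) ^ n"
proof -
  define n where "n = (LEAST n. d < 2 ^ n * r)"
  have "\<exists>n. d / r < 2 ^ n"
    using real_arch_pow [of 2] by simp
  then have "\<exists>n. d < 2 ^ n * r"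
    using assms(1) by (simp add: field_simps)
  then have n: "d < 2 ^ n * r"
    unfolding n_def by (rule LeastI_ex)
  have "(1 + c4 * (d / r)) powr (- dH - dW) \<le> annulus_const * (2 powr (- dH - dW)) ^ n"
  proof (cases n)
    case 0
    have "(1 + c4 * (d / r)) powr (- dH - dW) \<le> 1 powr (- dH - dW)"
      using assms c4_pos dH_pos dW_pos by (intro powr_mono2') auto
    then show ?thesis
      using 0 annulus_const_ge_1 by simp
  next
    case (Suc m)
    then have "\<not> d < 2 ^ m * r"
      using not_less_Least [of m "\<lambda>n. d < 2 ^ n * r"] by (simp add: n_def)
    then have "2 ^ m \<le> d / r"
      using assms(1) by (simp add: field_simps)
    then have "c4 * 2 ^ m \<le> 1 + c4 * (d / r)"
      using c4_pos by (smt (verit) mult_left_mono)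
    then have le: "c4 / 2 * 2 ^ n \<le> 1 + c4 * (d / r)"
      by (simp add: Suc)
    have "(1 + c4 * (d / r)) powr (- dH - dW) \<le> (c4 / 2 * 2 ^ n) powr (- dH - dW)"
      using le c4_pos dH_pos dW_pos by (intro powr_mono2') auto
    also have "\<dots> = (c4 / 2) powr (- dH - dW) * (2 powr (- dH - dW)) ^ n"
      using c4_pos powr_mult [of "c4 / 2" "2 ^ n" "- dH - dW"]
      by (simp add: powr_realpow [symmetric] powr_powr mult.commute)
    also have "\<dots> \<le> annulus_const * (2 powr (- dH - dW)) ^ n"
      by (intro mult_right_mono) (auto simp: annulus_const_def)
    finally show ?thesis .
  qed
  with n show ?thesis
    by blast
qed

text \<open>Here \<open>m\<close> stands for the p-th power of the metric seminorm: the assumption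
  is its bound at every radius, raised to the power \<open>p\<close>.\<close>

lemma kernel_integral_le:
  assumes "0 < r" "0 \<le> m" "f \<in> borel_measurable M"
    and "\<And>s. 0 < s \<Longrightarrow>
      (\<integral>\<^sup>+ z\<in>Delta s. ennreal (\<bar>f (fst z) - f (snd z)\<bar> powr p) \<partial>(M \<Otimes>\<^sub>M M))
        \<le> ennreal (m * s powr (p * \<alpha> * dW + dH))"
  shows "(\<integral>\<^sup>+ z. ennreal (\<bar>f (fst z) - f (snd z)\<bar> powr p * k (r powr dW) (fst z) (snd z)) \<partial>(M \<Otimes>\<^sub>M M))
    \<le> ennreal (series_const * m * r powr (p * \<alpha> * dW))"
proof -
  note [measurable] = assms(3)
  define q where "q = (\<lambda>z. \<bar>f (fst z) - f (snd z)\<bar> powr p)"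
  have [measurable]: "q \<in> borel_measurable (M \<Otimes>\<^sub>M M)"
    unfolding q_def by measurable
  \<comment> \<open>The bound for the kernel at pairs whose least dyadic radius is
    \<open>2 ^ n * r\<close>, used as the coefficient of the indicator of
    \<open>Delta (2 ^ n * r)\<close>.\<close>
  define a where "a = (\<lambda>n :: nat. c3 * annulus_const * r powr - dH * (2 powr (- dH - dW)) ^ n)"
  have a: "0 \<le> a n" for n
    using c3_pos annulus_const_ge_1 by (simp add: a_def)
  let ?g = "\<lambda>n z. ennreal (a n) * (ennreal (q z) * indicator (Delta (2 ^ n * r)) z)"
  have ratio: "2 powr (- dH - dW) * 2 powr (p * \<alpha> * dW + dH) = (2 :: real) powr (dW * (p * \<alpha> - 1))"
    by (simp add: powr_add [symmetric] algebra_simps)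
  \<comment> \<open>The growth exponent \<open>dH\<close> of the integral over
    \<open>Delta (2 ^ n * r)\<close> cancels the \<open>- dH\<close> of the kernel bound, both in
    \<open>r\<close> and in \<open>2 ^ n\<close>; what remains in \<open>n\<close> is purely
    geometric.\<close>
  have term_eq: "a n * (m * (2 ^ n * r) powr (p * \<alpha> * dW + dH)) =
      c3 * annulus_const * m * r powr (p * \<alpha> * dW) * (2 powr (dW * (p * \<alpha> - 1))) ^ n" for n
  proof -
    have "(2 ^ n * r) powr (p * \<alpha> * dW + dH)
        = (2 powr (p * \<alpha> * dW + dH)) ^ n * r powr (p * \<alpha> * dW) * r powr dH"
      using assms(1)
      by (simp add: powr_mult powr_realpow [symmetric] powr_powr mult.commute powr_add)
    moreover have "r powr - dH * r powr dH = 1"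
      using assms(1) by (simp add: powr_minus)
    ultimately show ?thesis
      unfolding ratio [symmetric] power_mult_distrib a_def by (simp add: mult_ac)
  qed
  have sums: "(\<lambda>n. a n * (m * (2 ^ n * r) powr (p * \<alpha> * dW + dH)))
      sums (series_const * m * r powr (p * \<alpha> * dW))"
    unfolding term_eq
    using sums_mult [OF geometric_sums [of "2 powr (dW * (p * \<alpha> - 1))"],
        of "c3 * annulus_const * m * r powr (p * \<alpha> * dW)"] ratio_less_1
    by (simp add: series_const_def)
  \<comment> \<open>At each point a single term, the one given by \<open>decay_le_annulus\<close>,
    already dominates; the other terms are nonnegative.\<close>
  have "AE z in M \<Otimes>\<^sub>M M. ennreal (q z * k (r powr dW) (fst z) (snd z)) \<le> (\<Sum>n. ?g n z)"
    using kernel_bounds_powr [OF assms(1)]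
  proof eventually_elim
    case (elim z)
    obtain n where n: "dist (fst z) (snd z) < 2 ^ n * r"
      "(1 + c4 * (dist (fst z) (snd z) / r)) powr (- dH - dW)
        \<le> annulus_const * (2 powr (- dH - dW)) ^ n"
      using decay_le_annulus [OF assms(1)] by (meson zero_le_dist)
    have "c3 * r powr - dH * (1 + c4 * (dist (fst z) (snd z) / r)) powr (- dH - dW)
        \<le> c3 * r powr - dH * (annulus_const * (2 powr (- dH - dW)) ^ n)"
      using n(2) c3_pos by (intro mult_left_mono) auto
    then have "k (r powr dW) (fst z) (snd z) \<le> a n"
      using elim by (simp add: a_def mult_ac)
    then have "q z * k (r powr dW) (fst z) (snd z) \<le> a n * q z"
      by (subst mult.commute [of "a n"]) (auto simp: q_def intro: mult_left_mono)
    moreover have "z \<in> Delta (2 ^ n * r)"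
      using n(1) by (simp add: Delta_def split_beta)
    ultimately have "ennreal (q z * k (r powr dW) (fst z) (snd z)) \<le> ?g n z"
      using a by (simp add: ennreal_mult' [symmetric] ennreal_leI)
    also have "\<dots> \<le> (\<Sum>n. ?g n z)"
      using sum_le_suminf [of "\<lambda>n. ?g n z" "{n}"] by simp
    finally show ?case .
  qed
  then have "(\<integral>\<^sup>+ z. ennreal (q z * k (r powr dW) (fst z) (snd z)) \<partial>(M \<Otimes>\<^sub>M M))
      \<le> (\<integral>\<^sup>+ z. (\<Sum>n. ?g n z) \<partial>(M \<Otimes>\<^sub>M M))"
    by (rule nn_integral_mono_AE)
  also have "\<dots> = (\<Sum>n. ennreal (a n) * (\<integral>\<^sup>+ z\<in>Delta (2 ^ n * r). ennreal (q z) \<partial>(M \<Otimes>\<^sub>M M)))"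
    by (simp add: nn_integral_suminf nn_integral_cmult)
  also have "\<dots> \<le> (\<Sum>n. ennreal (a n * (m * (2 ^ n * r) powr (p * \<alpha> * dW + dH))))"
    using assms(1) assms(4) a
    by (intro suminf_le) (auto simp: q_def ennreal_mult' intro: mult_left_mono)
  also have "\<dots> = ennreal (series_const * m * r powr (p * \<alpha> * dW))"
    using a assms(2) sums by (subst suminf_ennreal2) (auto simp: sums_iff)
  finally show ?thesis
    by (simp add: q_def)
qed

lemma besov_seminorm_le:
  assumes "f \<in> borel_measurable M"
  shows "besov_seminorm M k p \<alpha> f
    \<le> ennreal (series_const powr (1 / p)) * besov_metric_seminorm M dH dW p \<alpha> f"
proof (cases "besov_metric_seminorm M dH dW p \<alpha> f")
  case top
  then show ?thesis
    \<comment> \<open>Positivity of the constant matters, since \<open>0 * top = 0\<close> in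
      \<open>ennreal\<close>.\<close>
    using series_const_pos by (simp add: ennreal_mult_top)
next
  case (real n)
  \<comment> \<open>With \<open>n\<close> the finite value of the metric seminorm, the weight is
    cleared and the p-th root undone at each radius \<open>s\<close>; this is the hypothesis of
    \<open>kernel_integral_le\<close> with \<open>m = n powr p\<close>.\<close>
  have metric: "(\<integral>\<^sup>+ z\<in>Delta s. ennreal (\<bar>f (fst z) - f (snd z)\<bar> powr p) \<partial>(M \<Otimes>\<^sub>M M))
      \<le> ennreal (n powr p * s powr (p * \<alpha> * dW + dH))" (is "?J \<le> _") if "0 < s" for s
  proof -
    define b where "b = s powr (\<alpha> * dW + dH / p)"
    have b: "0 < b"
      using that by (simp add: b_def)
    have "ennreal (1 / b) * ennreal_powr ?J (1 / p) \<le> ennreal n"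
      using that unfolding real(2) [symmetric] besov_metric_seminorm_def b_def
      by (intro SUP_upper) auto
    then have "ennreal b * (ennreal (1 / b) * ennreal_powr ?J (1 / p)) \<le> ennreal b * ennreal n"
      by (rule mult_left_mono) simp
    then have "ennreal_powr ?J (1 / p) \<le> ennreal (b * n)"
      using b real(1) by (simp add: mult.assoc [symmetric] ennreal_mult'' [symmetric])
    then have "?J \<le> ennreal ((b * n) powr p)"
      using b real(1) p_pos by (intro ennreal_powr_le_imp_le) auto
    also have "(b * n) powr p = n powr p * s powr (p * \<alpha> * dW + dH)"
      using p_pos real(1) by (simp add: b_def powr_mult powr_powr algebra_simps)
    finally show ?thesis .
  qed
  show ?thesis
    unfolding besov_seminorm_def
  proof (intro SUP_least)
    fix t :: real
    assume "t \<in> {0<..}"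
    then have t: "0 < t"
      by simp
    define r where "r = t powr (1 / dW)"
    have r: "0 < r" "r powr dW = t"
      using t dW_pos by (auto simp: r_def powr_powr)
    let ?I = "\<integral>\<^sup>+ y. (\<integral>\<^sup>+ x. ennreal (\<bar>f x - f y\<bar> powr p * k t x y) \<partial>M) \<partial>M"
    have "?I \<le> ennreal (series_const * n powr p * r powr (p * \<alpha> * dW))"
      using kernel_integral_le [OF r(1) _ assms metric] double_integral_eq [OF t assms] r(2) by simp
    then have "ennreal_powr ?I (1 / p)
        \<le> ennreal ((series_const * n powr p * r powr (p * \<alpha> * dW)) powr (1 / p))"
      using p_pos series_const_pos
      by (subst ennreal_powr_ennreal [symmetric]) (auto intro: ennreal_powr_mono)
    also have "(series_const * n powr p * r powr (p * \<alpha> * dW)) powr (1 / p)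
        = series_const powr (1 / p) * n * t powr \<alpha>"
      using p_pos series_const_pos real(1)
      by (simp add: powr_mult powr_powr r(2) [symmetric] mult.commute)
    finally have "ennreal (t powr - \<alpha>) * ennreal_powr ?I (1 / p)
        \<le> ennreal (t powr - \<alpha>) * ennreal (series_const powr (1 / p) * n * t powr \<alpha>)"
      by (rule mult_left_mono) simp
    \<comment> \<open>The factor \<open>t powr \<alpha>\<close> from the scaling of the integral
      cancels the weight, so the bound is uniform in \<open>t\<close>.\<close>
    also have "\<dots> = ennreal (series_const powr (1 / p)) * ennreal n"
      using t real(1) by (simp add: ennreal_mult'' [symmetric] powr_minus field_simps)
    finally show "ennreal (t powr - \<alpha>) * ennreal_powr ?I (1 / p)
        \<le> ennreal (series_const powr (1 / p)) * besov_metric_seminorm M dH dW p \<alpha> f"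
      using real(2) by simp
  qed
qed

end

theorem theorem0p20:
  fixes M :: "'a::metric_space measure"
    and F :: "('a \<Rightarrow> real) set"
    and E :: "('a \<Rightarrow> real) \<Rightarrow> ('a \<Rightarrow> real) \<Rightarrow> real"
    and P :: "real \<Rightarrow> ('a \<Rightarrow> real) \<Rightarrow> 'a \<Rightarrow> real"
    and k :: "real \<Rightarrow> 'a \<Rightarrow> 'a \<Rightarrow> real"
    and dH dW c3 c4 c5 c6 p \<alpha> :: real
  assumes "metric_measure_space M"
    and "ahlfors_regular M dH"
    and "regular_dirichlet_form M F E"
    and "\<not> local_form M F E"
    and "heat_semigroup M F E P"
    and "conservative M P"
    and "heat_kernel M P k"
    and "0 < c3" "0 < c4" "0 < c5" "0 < c6"
    and "0 < dW" "dW \<le> dH + 1"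
    and "\<And>t. 0 < t \<Longrightarrow> AE (x, y) in M \<Otimes>\<^sub>M M.
           c5 * t powr (- (dH / dW)) * (1 + c6 * (dist x y / t powr (1 / dW))) powr (- dH - dW) \<le> k t x y \<and>
           k t x y \<le> c3 * t powr (- (dH / dW)) * (1 + c4 * (dist x y / t powr (1 / dW))) powr (- dH - dW)"
    and "1 \<le> p" "0 \<le> \<alpha>" "\<alpha> < 1 / p"
  shows "\<exists>c>0. \<exists>C>0. \<forall>f\<in>Lp p M.
           ennreal c * besov_metric_seminorm M dH dW p \<alpha> f \<le> besov_seminorm M k p \<alpha> f \<and>
           besov_seminorm M k p \<alpha> f \<le> ennreal C * besov_metric_seminorm M dH dW p \<alpha> f"
proof -
  interpret kernel_comparison M k dH dW c3 c4 c5 c6 p \<alpha>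
    using assms(2,7,15)
    by (intro kernel_comparison.intro ahlfors_regular_sigma_finite [of M dH] Delta_measurable assms)
       (auto simp: ahlfors_regular_def heat_kernel_def)
  \<comment> \<open>Both constants depend only on the exponents and the kernel constants, so they
    can be chosen before \<open>f\<close>.\<close>
  have "0 < (c5 * (1 + c6) powr (- dH - dW)) powr (1 / p)" "0 < series_const powr (1 / p)"
    using series_const_pos c5_pos c6_pos by simp_all
  then show ?thesis
    using besov_metric_seminorm_le besov_seminorm_le unfolding Lp_def by blast
qed

end
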